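(* Let $s,t \geq 1$ be integers and let $\beta_{s,t}$ be the type-$\beta$ comb with $s$ teeth of length $t$. Then the number of linear extensions of $\beta_{s,t}$ that avoid both patterns $213$ and $321$ equals $(s-1)(t-1)+1$.
   Context: A linear extension of a finite poset $P$ on a set of integers is a listing $v=[v_1,\dots,v_n]$ of all elements of $P$, each exactly once, such that whenever $a \leq_P b$, $a$ appears before $b$. For $w \in S_3$, a sequence $v$ of distinct integers contains $w$ if there are indices $i<j<k$ with $(v_i,v_j,v_k)$ in the same relative order as $(w_1,w_2,w_3)$; otherwise $v$ avoids $w$. The type-$\beta$ comb $\beta_{s,t}$ is the poset on $\{1,\dots,st\}$ whose order is generated by the relations $ct+1 \leq (c+1)t+1$ for $0 \leq c \leq s-2$ (the spine) and $ct+j \leq ct+j+1$ for $0 \leq c \leq s-1$, $1 \leq j \leq t-1$ (the teeth $\{ct+1,\dots,ct+t\}$). *)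

theory Defs
  imports Main
begin

text \<open>A poset is given by its carrier \<open>A\<close> and its order relation \<open>r\<close>, where
  \<open>(a, b) \<in> r\<close> means \<open>a \<le> b\<close>. The comparison of positions is weak because \<open>r\<close> is reflexive.\<close>

definition linear_extension :: "'a set \<Rightarrow> ('a \<times> 'a) set \<Rightarrow> 'a list \<Rightarrow> bool" where
  "linear_extension A r v \<longleftrightarrow>
     distinct v \<and> set v = A \<and>
     (\<forall>i < length v. \<forall>j < length v. (v ! i, v ! j) \<in> r \<longrightarrow> i \<le> j)"

definition same_relative_order :: "'a::linorder list \<Rightarrow> 'b::linorder list \<Rightarrow> bool" where
  "same_relative_order xs ys \<longleftrightarrow>
     length xs = length ys \<and>
     (\<forall>p < length xs. \<forall>q < length xs. xs ! p < xs ! q \<longleftrightarrow> ys ! p < ys ! q)"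

text \<open>Patterns \<open>w \<in> S\<^sub>3\<close> are given in one-line notation, e.g. \<open>[2, 1, 3]\<close>.\<close>

definition contains_pattern :: "'a::linorder list \<Rightarrow> nat list \<Rightarrow> bool" where
  "contains_pattern v w \<longleftrightarrow>
     (\<exists>i j k. i < j \<and> j < k \<and> k < length v \<and> same_relative_order [v ! i, v ! j, v ! k] w)"

definition avoids_pattern :: "'a::linorder list \<Rightarrow> nat list \<Rightarrow> bool" where
  "avoids_pattern v w \<longleftrightarrow> \<not> contains_pattern v w"

definition beta_comb_carrier :: "nat \<Rightarrow> nat \<Rightarrow> nat set" where
  "beta_comb_carrier s t = {1..s * t}"

text \<open>The bound \<open>c \<le> s - 2\<close> on spine relations is written \<open>c + 2 \<le> s\<close>, and likewise
  \<open>j \<le> t - 1\<close> as \<open>j + 1 \<le> t\<close>, to avoid truncated subtraction.\<close>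

definition beta_comb_generators :: "nat \<Rightarrow> nat \<Rightarrow> (nat \<times> nat) set" where
  "beta_comb_generators s t =
     {(c * t + 1, (c + 1) * t + 1) | c. c + 2 \<le> s} \<union>
     {(c * t + j, c * t + j + 1) | c j. c + 1 \<le> s \<and> 1 \<le> j \<and> j + 1 \<le> t}"

text \<open>The reflexive part of the closure is restricted to the carrier.\<close>

definition beta_comb_order :: "nat \<Rightarrow> nat \<Rightarrow> (nat \<times> nat) set" where
  "beta_comb_order s t = Restr ((beta_comb_generators s t)\<^sup>*) (beta_comb_carrier s t)"

lemma partial_order_on_beta_comb:
  "partial_order_on (beta_comb_carrier s t) (beta_comb_order s t)"
proof -
  have gen: "a \<le> b" if "(a, b) \<in> beta_comb_generators s t" for a b
    using that by (auto simp: beta_comb_generators_def)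
  have le: "a \<le> b" if "(a, b) \<in> (beta_comb_generators s t)\<^sup>*" for a b
    using that(1)
    by (induction rule: rtrancl_induct) (auto dest: gen intro: order_trans)
  show ?thesis
    unfolding partial_order_on_def preorder_on_def refl_on_def beta_comb_order_def
    by (auto intro!: antisymI transI dest: le intro: rtrancl_trans order_antisym)
qed

end

theory Submission
  imports Defs
begin

text \<open>
  Let \<open>v\<close> be a permutation of \<open>1, \<dots>, n\<close>. If \<open>v\<close> avoids
  both patterns, then the entries on either side of the maximum \<open>n\<close> increase, and no
  entry before \<open>n\<close> lies strictly between two entries after \<open>n\<close>. Hence the
  entries after \<open>n\<close> form an interval \<open>i + 1, \<dots>, j\<close>, and
  \<open>v\<close> is the identity with the blocks \<open>i + 1, \<dots>, j\<close> and \<open>j +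
  1, \<dots>, n\<close> exchanged. For \<open>i < j < n\<close> this is a linear extension of the
  comb iff no element of the first block lies below one of the second: \<open>j\<close> must be the
  tip \<open>k * t\<close> of a tooth other than the last, and the first block must not reach down
  to the root of that tooth. This leaves \<open>s - 1\<close> choices for \<open>k\<close> and
  \<open>t - 1\<close> for the length of the block, besides the identity.
\<close>

section \<open>Permutations avoiding 213 and 321\<close>

lemma avoids_213_iff:
  "avoids_pattern v [2, 1, 3] \<longleftrightarrow>
     (\<forall>i j k. i < j \<and> j < k \<and> k < length v \<longrightarrow> \<not> (v ! j < v ! i \<and> v ! i < v ! k))"
proof -
  have "same_relative_order [a, b, c] [2, 1, 3 :: nat] \<longleftrightarrow> b < a \<and> a < c" for a b c :: 'a
    by (auto simp: same_relative_order_def All_less_Suc numeral_3_eq_3)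
  then show ?thesis
    unfolding avoids_pattern_def contains_pattern_def by blast
qed

lemma avoids_321_iff:
  "avoids_pattern v [3, 2, 1] \<longleftrightarrow>
     (\<forall>i j k. i < j \<and> j < k \<and> k < length v \<longrightarrow> \<not> (v ! k < v ! j \<and> v ! j < v ! i))"
proof -
  have "same_relative_order [a, b, c] [3, 2, 1 :: nat] \<longleftrightarrow> c < b \<and> b < a" for a b c :: 'a
    by (auto simp: same_relative_order_def All_less_Suc numeral_3_eq_3)
  then show ?thesis
    unfolding avoids_pattern_def contains_pattern_def by blast
qed

text \<open>Empty blocks are allowed, so every choice with \<open>i = j\<close> or
  \<open>j = n\<close> yields the identity; among parameters with \<open>i < j < n\<close> the list
  determines them.\<close>

definition block_swap :: "nat \<Rightarrow> nat \<Rightarrow> nat \<Rightarrow> nat list" where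
  "block_swap i j n = [Suc 0..<Suc i] @ [Suc j..<Suc n] @ [Suc i..<Suc j]"

lemma length_block_swap: "i \<le> j \<Longrightarrow> j \<le> n \<Longrightarrow> length (block_swap i j n) = n"
  by (auto simp: block_swap_def simp del: upt_Suc)

lemma nth_block_swap:
  assumes "i \<le> j" "j \<le> n" "p < n"
  shows "block_swap i j n ! p =
    (if p < i then p + 1 else if p < i + (n - j) then p + 1 + (j - i) else p + 1 - (n - j))"
  using assms by (auto simp: block_swap_def nth_append simp del: upt_Suc)

lemma set_block_swap: "i \<le> j \<Longrightarrow> j \<le> n \<Longrightarrow> set (block_swap i j n) = {1..n}"
  by (auto simp: block_swap_def simp del: upt_Suc)

lemma distinct_block_swap: "i \<le> j \<Longrightarrow> j \<le> n \<Longrightarrow> distinct (block_swap i j n)"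
  by (auto simp: block_swap_def simp del: upt_Suc)

lemma block_swap_trivial:
  assumes "i \<le> j" "j \<le> n" "i = j \<or> j = n"
  shows "block_swap i j n = [1..<Suc n]"
  by (rule nth_equalityI)
    (use assms in \<open>auto simp: length_block_swap nth_block_swap simp del: upt_Suc\<close>)

text \<open>An inversion can only pair an entry of the upper block with one of the lower block,
  which comes last. So no entry ends one inversion and starts another (321), and everything after an
  inversion is below its larger entry (213).\<close>

lemma block_swap_avoids:
  assumes "i \<le> j" "j \<le> n"
  shows "avoids_pattern (block_swap i j n) [2, 1, 3]" "avoids_pattern (block_swap i j n) [3, 2, 1]"
  using assms unfolding avoids_213_iff avoids_321_iff
  by (auto simp: length_block_swap nth_block_swap split: if_splits)

lemma block_swap_inject:
  assumes "i < j" "j < n" "i' < j'" "j' < n" "block_swap i j n = block_swap i' j' n"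
  shows "i = i' \<and> j = j'"
proof -
  have "last (block_swap i j n) = j" "last (block_swap i' j' n) = j'"
    using assms by (auto simp: block_swap_def)
  then have j: "j = j'"
    using assms by simp
  have eq: "block_swap i j n ! p = block_swap i' j' n ! p" for p
    using assms by simp
  \<comment> \<open>Counting from 0, position \<open>i\<close> is the first where the list departs
    from the identity: it holds \<open>j + 1\<close> instead of \<open>i + 1\<close>.\<close>
  have "i = i'"
    using eq[of i] eq[of i'] j assms by (auto simp: nth_block_swap split: if_splits)
  with j show ?thesis by simp
qed

lemma avoiding_imp_block_swap:
  fixes v :: "nat list"
  assumes dist: "distinct v" and set: "set v = {1..n}"
    and av: "avoids_pattern v [2, 1, 3]" "avoids_pattern v [3, 2, 1]"
  shows "\<exists>i j. i \<le> j \<and> j \<le> n \<and> v = block_swap i j n"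
proof (cases "n = 0")
  case True
  then show ?thesis using set by (auto simp: block_swap_def)
next
  case False
  then have "n \<in> set v" using set by auto
  then obtain xs ys where v: "v = xs @ n # ys"
    by (meson split_list)
  have le: "x < n" if "x \<in> set xs \<union> set ys" for x
  proof -
    have "x \<in> {1..n}" using set that v by auto
    moreover have "x \<noteq> n" using dist that v by auto
    ultimately show ?thesis by auto
  qed
  \<comment> \<open>A descent before the maximum, followed by it, would be a 213.\<close>
  have xs: "sorted xs"
    unfolding sorted_iff_nth_mono_less
  proof (intro allI impI)
    fix p q assume pq: "p < q" "q < length xs"
    then have "\<not> (v ! q < v ! p \<and> v ! p < v ! length xs)"
      using av(1)[unfolded avoids_213_iff, rule_format, of p q "length xs"] v by simp
    then show "xs ! p \<le> xs ! q"
      using pq le[of "xs ! p"] v by (auto simp: nth_append)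
  qed
  \<comment> \<open>A descent after the maximum, preceded by it, would be a 321.\<close>
  have ys: "sorted ys"
    unfolding sorted_iff_nth_mono_less
  proof (intro allI impI)
    fix p q assume pq: "p < q" "q < length ys"
    then have "\<not> (v ! (length xs + Suc q) < v ! (length xs + Suc p)
                 \<and> v ! (length xs + Suc p) < v ! length xs)"
      using av(2)[unfolded avoids_321_iff, rule_format,
          of "length xs" "length xs + Suc p" "length xs + Suc q"] v by simp
    then show "ys ! p \<le> ys ! q"
      using pq le[of "ys ! p"] v by (auto simp: nth_append)
  qed
  \<comment> \<open>Since \<open>ys\<close> increases, \<open>a\<close> comes before
    \<open>c\<close>, so \<open>b\<close>, \<open>a\<close>, \<open>c\<close> would form a
    213.\<close>
  have gap: False if "b \<in> set xs" "a \<in> set ys" "c \<in> set ys" "a < b" "b < c" for a b c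
  proof -
    from that obtain p q r where p: "p < length xs" "xs ! p = b"
      and q: "q < length ys" "ys ! q = a" and r: "r < length ys" "ys ! r = c"
      by (metis in_set_conv_nth)
    have "q < r"
    proof (rule ccontr)
      assume "\<not> q < r"
      then have "ys ! r \<le> ys ! q"
        using ys q(1) by (auto intro: sorted_nth_mono)
      with q r that show False by simp
    qed
    then have "\<not> (v ! (length xs + Suc q) < v ! p \<and> v ! p < v ! (length xs + Suc r))"
      using av(1)[unfolded avoids_213_iff, rule_format,
          of p "length xs + Suc q" "length xs + Suc r"] v p q r by simp
    then show False
      using p q r that v by (auto simp: nth_append)
  qed
  have dist': "distinct xs" "distinct ys" "set xs \<inter> set ys = {}"
    using dist v by auto
  have set_v: "insert n (set xs \<union> set ys) = {1..n}"
    using set v by auto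
  show ?thesis
  proof (cases "ys = []")
    case True
    have "v = [1..<Suc n]"
      by (rule sorted_distinct_set_unique)
        (use True v xs dist set le in \<open>auto simp: sorted_append less_imp_le simp del: upt_Suc\<close>)
    then show ?thesis
      using block_swap_trivial[of n n n] by (metis le_refl)
  next
    case False
    define i where "i = Min (set ys) - 1"
    define j where "j = Max (set ys)"
    have Min_in: "Min (set ys) \<in> set ys" and Max_in: "j \<in> set ys"
      using False by (auto simp: j_def)
    have "Min (set ys) \<ge> 1" using Min_in set v by auto
    then have i: "Suc i = Min (set ys)" by (simp add: i_def)
    have bounds: "Suc i \<le> y \<and> y \<le> j" if "y \<in> set ys" for y
      using that by (auto simp: i j_def)
    have ij: "Suc i \<le> j" using Max_in bounds by blast
    have jn: "j < n" using Max_in le by blast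
    have set_ys: "set ys = {Suc i..j}"
    proof
      show "set ys \<subseteq> {Suc i..j}" using bounds by auto
      \<comment> \<open>A missing value would lie in \<open>xs\<close>, strictly between the
        extremes \<open>Suc i\<close> and \<open>j\<close> of \<open>ys\<close>, contrary to
        \<open>gap\<close>.\<close>
      show "{Suc i..j} \<subseteq> set ys"
      proof
        fix b assume b: "b \<in> {Suc i..j}"
        show "b \<in> set ys"
        proof (rule ccontr)
          assume nb: "b \<notin> set ys"
          have "b \<in> {1..n}" using b jn by auto
          then have "b \<in> insert n (set xs \<union> set ys)" by (simp only: set_v)
          then have "b \<in> set xs" using nb b jn by auto
          moreover have "b \<noteq> Suc i" "b \<noteq> j" using nb Min_in Max_in i by auto
          ultimately show False
            using gap[of b "Suc i" j] Min_in Max_in i b by auto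
        qed
      qed
    qed
    have "ys = [Suc i..<Suc j]"
      by (rule sorted_distinct_set_unique) (use ys dist' set_ys in \<open>auto simp del: upt_Suc\<close>)
    \<comment> \<open>The maximum closes the increasing run begun by \<open>xs\<close>; both sides
      list \<open>{1..n}\<close> without \<open>{Suc i..j}\<close> in increasing order.\<close>
    moreover have "xs @ [n] = [Suc 0..<Suc i] @ [Suc j..<Suc n]"
    proof (rule sorted_distinct_set_unique)
      have "set (xs @ [n]) = {1..n} - {Suc i..j}"
        using set_v dist'(3) set_ys jn by auto
      also have "\<dots> = set ([Suc 0..<Suc i] @ [Suc j..<Suc n])"
        using ij jn by auto
      finally show "set (xs @ [n]) = set ([Suc 0..<Suc i] @ [Suc j..<Suc n])" .
    qed (use xs le dist v ij in \<open>auto simp: sorted_append less_imp_le simp del: upt_Suc\<close>)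
    ultimately have "v = block_swap i j n"
      unfolding block_swap_def v by (metis append.assoc append_Cons append_Nil)
    then show ?thesis using ij jn by (intro exI[of _ i] exI[of _ j]) auto
  qed
qed

section \<open>Linear extensions of the comb\<close>

text \<open>Contraposition turns the condition on positions into one on pairs of entries, which
  splits along a concatenation of blocks.\<close>

lemma linear_extension_iff_sorted_wrt:
  "linear_extension A r v \<longleftrightarrow> distinct v \<and> set v = A \<and> sorted_wrt (\<lambda>x y. (y, x) \<notin> r) v"
  unfolding linear_extension_def sorted_wrt_iff_nth_less
  by (meson leD leI order.strict_trans)

lemma beta_comb_order_le: "(a, b) \<in> beta_comb_order s t \<Longrightarrow> a \<le> b"
proof -
  assume "(a, b) \<in> beta_comb_order s t"
  then have "(a, b) \<in> (beta_comb_generators s t)\<^sup>*"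
    by (simp add: beta_comb_order_def)
  then show "a \<le> b"
    by (induction rule: rtrancl_induct) (auto simp: beta_comb_generators_def)
qed

lemma sorted_wrt_beta_comb_upt: "sorted_wrt (\<lambda>x y. (y, x) \<notin> beta_comb_order s t) [a..<b]"
  by (rule sorted_wrt_mono_rel[OF _ sorted_wrt_upt]) (auto dest: beta_comb_order_le)

lemma linear_extension_upt:
  "linear_extension (beta_comb_carrier s t) (beta_comb_order s t) [1..<Suc (s * t)]"
  unfolding linear_extension_iff_sorted_wrt
  by (auto simp: beta_comb_carrier_def sorted_wrt_beta_comb_upt simp del: upt_Suc)

text \<open>The comb order is contained in the order of the integers, so only inverted pairs can
  violate it, and these are the pairs across the two exchanged blocks.\<close>

lemma linear_extension_block_swap_iff:
  assumes "i \<le> j" "j \<le> s * t"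
  shows "linear_extension (beta_comb_carrier s t) (beta_comb_order s t) (block_swap i j (s * t)) \<longleftrightarrow>
    (\<forall>b\<in>{Suc i..j}. \<forall>c\<in>{Suc j..s * t}. (b, c) \<notin> beta_comb_order s t)"
proof -
  have "(y, x) \<notin> beta_comb_order s t" if "x < y" for x y
    using that by (auto dest: beta_comb_order_le)
  then have "sorted_wrt (\<lambda>x y. (y, x) \<notin> beta_comb_order s t) (block_swap i j (s * t)) \<longleftrightarrow>
    (\<forall>b\<in>{Suc i..j}. \<forall>c\<in>{Suc j..s * t}. (b, c) \<notin> beta_comb_order s t)"
    using assms
    by (auto simp: block_swap_def sorted_wrt_append sorted_wrt_beta_comb_upt simp del: upt_Suc)
  then show ?thesis
    using assms
    by (simp add: linear_extension_iff_sorted_wrt distinct_block_swap set_block_swap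
        beta_comb_carrier_def)
qed

lemma beta_comb_generator_in_order:
  assumes "(a, b) \<in> beta_comb_generators s t" "1 \<le> a" "b \<le> s * t"
  shows "(a, b) \<in> beta_comb_order s t"
proof -
  have "a \<le> b" using assms(1) by (auto simp: beta_comb_generators_def)
  then show ?thesis
    using assms by (auto simp: beta_comb_order_def beta_comb_carrier_def)
qed

text \<open>Spine generators start at roots and tooth generators stop at the tip, so no chain
  starting above the root of a tooth leaves that tooth.\<close>

lemma beta_comb_order_tooth:
  assumes "(a, b) \<in> beta_comb_order s t" "k * t + 1 < a" "a \<le> (k + 1) * t"
  shows "b \<le> (k + 1) * t"
proof -
  have "(a, b) \<in> (beta_comb_generators s t)\<^sup>*"
    using assms(1) by (simp add: beta_comb_order_def)
  \<comment> \<open>The lower bound is carried along to keep the chain off the root, where a spine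
    generator could lead away.\<close>
  then have "k * t + 1 < b \<and> b \<le> (k + 1) * t"
  proof (induction rule: rtrancl_induct)
    case base
    then show ?case using assms by simp
  next
    case (step y z)
    from step.hyps(2) consider (spine) c where "y = c * t + 1"
      | (tooth) c j where "y = c * t + j" "z = c * t + j + 1" "1 \<le> j" "j + 1 \<le> t"
      by (auto simp: beta_comb_generators_def)
    then show ?case
    proof cases
      case spine
      then have "k * t < c * t" "c * t < (k + 1) * t" using step.IH by auto
      then have "k < c" "c < k + 1" by (metis mult_less_cancel2)+
      then show ?thesis by simp
    next
      case tooth
      \<comment> \<open>The residue \<open>j\<close> is nonzero, so \<open>y\<close> is not the tip
        and its successor stays in the tooth.\<close>
      have "y mod t = j" using tooth by simp
      then have "y \<noteq> (k + 1) * t"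
        using tooth by (metis mod_mult_self2_is_0 not_one_le_zero)
      then show ?thesis using step.IH tooth by auto
    qed
  qed
  then show ?thesis by simp
qed

lemma linear_extension_block_swap_cases:
  assumes "i < j" "j < s * t"
  shows "linear_extension (beta_comb_carrier s t) (beta_comb_order s t) (block_swap i j (s * t)) \<longleftrightarrow>
    (\<exists>k m. k \<in> {1..<s} \<and> m \<in> {1..<t} \<and> i = k * t - m \<and> j = k * t)"
    (is "?L \<longleftrightarrow> ?R")
proof -
  have "0 < t" using assms by (cases t) auto
  have iff: "?L \<longleftrightarrow> (\<forall>b\<in>{Suc i..j}. \<forall>c\<in>{Suc j..s * t}. (b, c) \<notin> beta_comb_order s t)"
    using assms by (intro linear_extension_block_swap_iff) auto
  show ?thesis
  proof
    assume ?L
    then have no: "(b, c) \<notin> beta_comb_order s t" if "i < b" "b \<le> j" "j < c" "c \<le> s * t" for b c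
      using iff that by auto
    \<comment> \<open>Otherwise \<open>j\<close> and \<open>j + 1\<close> are consecutive in one
      tooth and the swap reverses them.\<close>
    have "j mod t = 0"
    proof (rule ccontr)
      assume "j mod t \<noteq> 0"
      moreover have "j mod t < t" using \<open>0 < t\<close> by simp
      moreover have "j div t < s"
        using assms(2) by (simp add: less_mult_imp_div_less)
      ultimately have "(j div t * t + j mod t, j div t * t + j mod t + 1) \<in> beta_comb_generators s t"
        unfolding beta_comb_generators_def
        by (intro UnI2 CollectI exI[of _ "j div t"] exI[of _ "j mod t"]) auto
      then have "(j, j + 1) \<in> beta_comb_order s t"
        using assms by (intro beta_comb_generator_in_order) auto
      then show False using no[of j "j + 1"] assms by auto
    qed
    then obtain k where j: "j = k * t" by (metis dvdE mod_0_imp_dvd mult.commute)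
    have "k < s" using assms(2) j by simp
    have "k \<noteq> 0" using assms(1) j by (cases k) auto
    then obtain k' where k: "k = k' + 1" by (metis Suc_eq_plus1 not0_implies_Suc)
    \<comment> \<open>Otherwise the first block contains the root of the tooth with tip
      \<open>j\<close>, while the next root \<open>j + 1\<close> lies in the second block.\<close>
    have "k' * t + 1 \<le> i"
    proof (rule ccontr)
      assume neg: "\<not> k' * t + 1 \<le> i"
      have "(k' * t + 1, (k' + 1) * t + 1) \<in> beta_comb_generators s t"
        using \<open>k < s\<close> k unfolding beta_comb_generators_def
        by (intro UnI1 CollectI exI conjI refl) auto
      then have "(k' * t + 1, j + 1) \<in> beta_comb_order s t"
        using assms j k by (intro beta_comb_generator_in_order) auto
      then show False
        using no[of "k' * t + 1" "j + 1"] neg assms j k \<open>0 < t\<close> by auto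
    qed
    \<comment> \<open>The length \<open>j - i\<close> of the first block serves as \<open>m\<close>;
      it is below \<open>t\<close> because the root stays outside the block.\<close>
    then have "k * t - i \<in> {1..<t}" "i = k * t - (k * t - i)"
      using assms j k by auto
    then show ?R
      using j \<open>k < s\<close> \<open>k \<noteq> 0\<close> by (intro exI[of _ k] exI[of _ "k * t - i"]) auto
  next
    assume ?R
    then obtain k m where km: "k \<in> {1..<s}" "m \<in> {1..<t}" "i = k * t - m" "j = k * t" by blast
    then obtain k' where k: "k = k' + 1"
      by (metis Suc_eq_plus1 atLeastLessThan_iff not0_implies_Suc not_one_le_zero)
    \<comment> \<open>As \<open>m < t\<close>, the first block holds only non-root elements of the
      tooth with tip \<open>j\<close>, and nothing beyond that tip is above them.\<close>
    have "(b, c) \<notin> beta_comb_order s t" if "b \<in> {Suc i..j}" "c \<in> {Suc j..s * t}" for b c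
    proof
      assume "(b, c) \<in> beta_comb_order s t"
      moreover have "k' * t + 1 < b" "b \<le> (k' + 1) * t" using that km k by auto
      ultimately have "c \<le> (k' + 1) * t" by (rule beta_comb_order_tooth)
      then show False using that km k by auto
    qed
    then show ?L using iff by blast
  qed
qed

section \<open>Enumeration of the avoiding linear extensions\<close>

lemma avoiding_linear_extensions_eq:
  "{v. linear_extension (beta_comb_carrier s t) (beta_comb_order s t) v \<and>
       avoids_pattern v [2, 1, 3] \<and> avoids_pattern v [3, 2, 1]} =
   insert [1..<Suc (s * t)]
     ((\<lambda>(k, m). block_swap (k * t - m) (k * t) (s * t)) ` ({1..<s} \<times> {1..<t}))"
  (is "?V = insert ?id (?f ` ?I)")
proof (intro equalityI subsetI)
  fix v assume v: "v \<in> ?V"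
  then have "distinct v" "set v = {1..s * t}"
    by (auto simp: linear_extension_def beta_comb_carrier_def)
  then obtain i j where ij: "i \<le> j" "j \<le> s * t" "v = block_swap i j (s * t)"
    using avoiding_imp_block_swap v by blast
  show "v \<in> insert ?id (?f ` ?I)"
  proof (cases "i = j \<or> j = s * t")
    case True
    then show ?thesis using ij block_swap_trivial by blast
  next
    case False
    then have "i < j" "j < s * t" using ij by auto
    then obtain k m where "k \<in> {1..<s}" "m \<in> {1..<t}" "i = k * t - m" "j = k * t"
      using v ij(3) linear_extension_block_swap_cases by blast
    then show ?thesis using ij(3) by force
  qed
next
  fix v assume "v \<in> insert ?id (?f ` ?I)"
  then consider "v = ?id"
    | k m where "k \<in> {1..<s}" "m \<in> {1..<t}" "v = block_swap (k * t - m) (k * t) (s * t)"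
    by auto
  then show "v \<in> ?V"
  proof cases
    case 1
    \<comment> \<open>The identity is the swap with all parameters \<open>s * t\<close>, so it
      inherits avoidance.\<close>
    then show ?thesis
      using linear_extension_upt block_swap_avoids[of "s * t" "s * t" "s * t"]
        block_swap_trivial[of "s * t" "s * t" "s * t"] by auto
  next
    case 2
    then have lt: "k * t - m < k * t" "k * t < s * t" by auto
    then have "linear_extension (beta_comb_carrier s t) (beta_comb_order s t) v"
      using 2 linear_extension_block_swap_cases by blast
    then show ?thesis using 2 lt block_swap_avoids by simp
  qed
qed

theorem theorem19:
  fixes s t :: nat
  assumes "s \<ge> 1" and "t \<ge> 1"
  shows "card {v. linear_extension (beta_comb_carrier s t) (beta_comb_order s t) v \<and>
                  avoids_pattern v [2, 1, 3] \<and> avoids_pattern v [3, 2, 1]}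
         = (s - 1) * (t - 1) + 1"
proof -
  let ?f = "\<lambda>(k, m). block_swap (k * t - m) (k * t) (s * t)"
  let ?I = "{1..<s} \<times> {1..<t}"
  \<comment> \<open>The bound \<open>m < k * t\<close> makes the truncated difference exact, so that
    \<open>m\<close> can be recovered from it.\<close>
  have lt: "k * t - m < k * t" "k * t < s * t" "m < k * t"
    if "k \<in> {1..<s}" "m \<in> {1..<t}" for k m
  proof -
    have "t \<le> k * t" using that by simp
    then show "m < k * t" using that(2) by (metis atLeastLessThan_iff less_le_trans)
  qed (use that in auto)
  have "inj_on ?f ?I"
  proof (rule inj_onI, clarify)
    fix k m k' m'
    assume I: "k \<in> {1..<s}" "m \<in> {1..<t}" "k' \<in> {1..<s}" "m' \<in> {1..<t}"
      and eq: "block_swap (k * t - m) (k * t) (s * t) = block_swap (k' * t - m') (k' * t) (s * t)"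
    have "k * t - m = k' * t - m' \<and> k * t = k' * t"
      using block_swap_inject[OF lt(1,2)[OF I(1,2)] lt(1,2)[OF I(3,4)] eq] .
    then show "k = k' \<and> m = m'"
      using lt(3)[OF I(1,2)] lt(3)[OF I(3,4)] I by auto
  qed
  \<comment> \<open>The last entry decides: it is \<open>k * t < s * t\<close> for a swap and
    \<open>s * t\<close> for the identity.\<close>
  moreover have "[1..<Suc (s * t)] \<notin> ?f ` ?I"
  proof clarify
    fix k m assume I: "k \<in> {1..<s}" "m \<in> {1..<t}"
      and eq: "[1..<Suc (s * t)] = block_swap (k * t - m) (k * t) (s * t)"
    have "last (block_swap (k * t - m) (k * t) (s * t)) = k * t"
      using lt[OF I] by (simp add: block_swap_def)
    moreover have "last [1..<Suc (s * t)] = s * t"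
      using assms by simp
    ultimately show False using eq lt(2)[OF I] by (metis less_irrefl)
  qed
  ultimately show ?thesis
    unfolding avoiding_linear_extensions_eq
    by (simp add: card_image card_cartesian_product del: upt_Suc)
qed

end
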